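(* Let $\mathcal{S}$ be an inverse semigroupoid. Then there exists a bundle $\pi\colon X\to X^{(0)}$ (that is, a function between sets) such that $\mathcal{S}$ is isomorphic to a sub-inverse semigroupoid of $\mathcal{I}(\pi)$.
   Context: A semigroupoid is a set $\Lambda$ with a subset $\Lambda^{[2]}\subseteq\Lambda\times\Lambda$ and a product $\Lambda^{[2]}\to\Lambda$, $(f,g)\mapsto fg$, such that for all $f,g,h\in\Lambda$ the statements (i) $(f,g),(g,h)\in\Lambda^{[2]}$; (ii) $(f,g),(fg,h)\in\Lambda^{[2]}$; (iii) $(g,h),(f,gh)\in\Lambda^{[2]}$ are equivalent, and if they hold then $(fg)h=f(gh)$. "$fg$ is defined" means $(f,g)\in\Lambda^{[2]}$. An inverse semigroupoid is a semigroupoid $\mathcal{S}$ such that for every $a\in\mathcal{S}$ there is a unique $a^*\in\mathcal{S}$ such that $aa^*$ and $a^*a$ are defined, $aa^*a=a$ and $a^*aa^*=a^*$. A homomorphism $\phi\colon\Lambda\to\Gamma$ of semigroupoids is a map such that whenever $ab$ is defined, $\phi(a)\phi(b)$ is defined and equals $\phi(ab)$; an isomorphism is a bijective homomorphism whose inverse is a homomorphism. A sub-inverse semigroupoid of an inverse semigroupoid is a subset closed under all defined products and under $a\mapsto a^*$, with the restricted product (for two elements of the subset, the product is defined in the subset if and only if it is defined in the ambient semigroupoid). For a bundle $\pi\colon X\to X^{(0)}$, $\mathcal{I}(\pi)$ is the set of triples $(y,f,x)$ with $x,y\in X^{(0)}$ and $f\colon\operatorname{dom}(f)\to\operatorname{ran}(f)$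 a bijection with $\operatorname{dom}(f)\subseteq\pi^{-1}(x)$ and $\operatorname{ran}(f)\subseteq\pi^{-1}(y)$. The product $(z,g,y')(y,f,x)$ is defined if and only if $y'=y$, and then $(z,g,y)(y,f,x)=(z,g\circ f,x)$, where $g\circ f$ is the usual partial composition with domain $f^{-1}(\operatorname{ran}(f)\cap\operatorname{dom}(g))$. This is an inverse semigroupoid with $(y,f,x)^*=(x,f^{-1},y)$. *)

theory Defs
  imports Main "HOL-Library.FuncSet"
begin

record 'a partial_magma =
  carrier :: "'a set"
  composable :: "('a \<times> 'a) set"
  mult :: "'a \<Rightarrow> 'a \<Rightarrow> 'a" (infixl "\<odot>\<index>" 70)

text \<open>The field \<^term>\<open>composable\<close> is the set \<open>\<Lambda>\<^sup>[\<^sup>2\<^sup>]\<close>; values of \<^term>\<open>mult\<close> outside it are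
  irrelevant.\<close>

locale semigroupoid =
  fixes \<Lambda> (structure)
  assumes composable_subset: "composable \<Lambda> \<subseteq> carrier \<Lambda> \<times> carrier \<Lambda>"
    and mult_closed: "(f, g) \<in> composable \<Lambda> \<Longrightarrow> f \<odot> g \<in> carrier \<Lambda>"
    and composable_left_iff: "\<lbrakk>f \<in> carrier \<Lambda>; g \<in> carrier \<Lambda>; h \<in> carrier \<Lambda>\<rbrakk> \<Longrightarrow>
      (f, g) \<in> composable \<Lambda> \<and> (g, h) \<in> composable \<Lambda> \<longleftrightarrow>
      (f, g) \<in> composable \<Lambda> \<and> (f \<odot> g, h) \<in> composable \<Lambda>"
    and composable_right_iff: "\<lbrakk>f \<in> carrier \<Lambda>; g \<in> carrier \<Lambda>; h \<in> carrier \<Lambda>\<rbrakk> \<Longrightarrow>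
      (f, g) \<in> composable \<Lambda> \<and> (g, h) \<in> composable \<Lambda> \<longleftrightarrow>
      (g, h) \<in> composable \<Lambda> \<and> (f, g \<odot> h) \<in> composable \<Lambda>"
    and assoc: "\<lbrakk>(f, g) \<in> composable \<Lambda>; (g, h) \<in> composable \<Lambda>\<rbrakk> \<Longrightarrow>
      (f \<odot> g) \<odot> h = f \<odot> (g \<odot> h)"

definition is_inverse :: "('a, 'm) partial_magma_scheme \<Rightarrow> 'a \<Rightarrow> 'a \<Rightarrow> bool" where
  "is_inverse S a b \<longleftrightarrow> b \<in> carrier S \<and> (a, b) \<in> composable S \<and> (b, a) \<in> composable S \<and>
     (a \<odot>\<^bsub>S\<^esub> b) \<odot>\<^bsub>S\<^esub> a = a \<and> (b \<odot>\<^bsub>S\<^esub> a) \<odot>\<^bsub>S\<^esub> b = b"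

locale inverse_semigroupoid = semigroupoid S for S (structure) +
  assumes ex1_inverse: "a \<in> carrier S \<Longrightarrow> \<exists>!b. is_inverse S a b"

definition star :: "('a, 'm) partial_magma_scheme \<Rightarrow> 'a \<Rightarrow> 'a" where
  "star S a = (THE b. is_inverse S a b)"

definition semigroupoid_hom ::
    "('a, 'm) partial_magma_scheme \<Rightarrow> ('b, 'n) partial_magma_scheme \<Rightarrow> ('a \<Rightarrow> 'b) \<Rightarrow> bool" where
  "semigroupoid_hom \<Lambda> \<Gamma> \<phi> \<longleftrightarrow> \<phi> \<in> carrier \<Lambda> \<rightarrow> carrier \<Gamma> \<and>
     (\<forall>a b. (a, b) \<in> composable \<Lambda> \<longrightarrow>
        (\<phi> a, \<phi> b) \<in> composable \<Gamma> \<and> \<phi> (a \<odot>\<^bsub>\<Lambda>\<^esub> b) = \<phi> a \<odot>\<^bsub>\<Gamma>\<^esub> \<phi> b)"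

definition semigroupoid_iso ::
    "('a, 'm) partial_magma_scheme \<Rightarrow> ('b, 'n) partial_magma_scheme \<Rightarrow> ('a \<Rightarrow> 'b) \<Rightarrow> bool" where
  "semigroupoid_iso \<Lambda> \<Gamma> \<phi> \<longleftrightarrow> semigroupoid_hom \<Lambda> \<Gamma> \<phi> \<and> bij_betw \<phi> (carrier \<Lambda>) (carrier \<Gamma>) \<and>
     semigroupoid_hom \<Gamma> \<Lambda> (inv_into (carrier \<Lambda>) \<phi>)"

definition isomorphic ::
    "('a, 'm) partial_magma_scheme \<Rightarrow> ('b, 'n) partial_magma_scheme \<Rightarrow> bool" where
  "isomorphic \<Lambda> \<Gamma> \<longleftrightarrow> (\<exists>\<phi>. semigroupoid_iso \<Lambda> \<Gamma> \<phi>)"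

locale sub_inverse_semigroupoid = inverse_semigroupoid S for S (structure) +
  fixes B
  assumes sub_carrier: "B \<subseteq> carrier S"
    and sub_mult_closed: "\<lbrakk>a \<in> B; b \<in> B; (a, b) \<in> composable S\<rbrakk> \<Longrightarrow> a \<odot> b \<in> B"
    and sub_star_closed: "a \<in> B \<Longrightarrow> star S a \<in> B"

definition restrict_magma :: "'a partial_magma \<Rightarrow> 'a set \<Rightarrow> 'a partial_magma" where
  "restrict_magma S B =
     \<lparr>carrier = B, composable = composable S \<inter> B \<times> B, mult = mult S\<rparr>"

definition is_bundle :: "('x \<Rightarrow> 'v) \<Rightarrow> 'x set \<Rightarrow> 'v set \<Rightarrow> bool" where
  "is_bundle \<pi> X X0 \<longleftrightarrow> \<pi> \<in> X \<rightarrow> X0"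

text \<open>A bijection from \<open>dom f\<close> onto \<open>ran f\<close> is a partial map \<open>f\<close> that is injective on its
  domain. Partial composition is \<^term>\<open>map_comp\<close>: \<open>g \<circ>\<^sub>m f\<close> is defined at the points that \<open>f\<close>
  sends into \<open>dom g\<close>.\<close>

definition bundle_bijections ::
    "('x \<Rightarrow> 'v) \<Rightarrow> 'x set \<Rightarrow> 'v set \<Rightarrow> ('v \<times> ('x \<rightharpoonup> 'x) \<times> 'v) set" where
  "bundle_bijections \<pi> X X0 = {(y, f, x). y \<in> X0 \<and> x \<in> X0 \<and> inj_on f (dom f) \<and>
     dom f \<subseteq> {p \<in> X. \<pi> p = x} \<and> ran f \<subseteq> {p \<in> X. \<pi> p = y}}"

definition bundle_semigroupoid ::
    "('x \<Rightarrow> 'v) \<Rightarrow> 'x set \<Rightarrow> 'v set \<Rightarrow> ('v \<times> ('x \<rightharpoonup> 'x) \<times> 'v) partial_magma" ("\<I>") where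
  "\<I> \<pi> X X0 =
     \<lparr>carrier = bundle_bijections \<pi> X X0,
      composable = {((z, g, y'), (y, f, x)). (z, g, y') \<in> bundle_bijections \<pi> X X0 \<and>
                      (y, f, x) \<in> bundle_bijections \<pi> X X0 \<and> y' = y},
      mult = (\<lambda>(z, g, y') (y, f, x). (z, g \<circ>\<^sub>m f, x))\<rparr>"

definition map_inverse :: "('x \<rightharpoonup> 'x) \<Rightarrow> ('x \<rightharpoonup> 'x)" where
  "map_inverse f = (\<lambda>q. if q \<in> ran f then Some (THE p. f p = Some q) else None)"

lemma map_inverse_eq_Some_iff:
  assumes "inj_on f (dom f)"
  shows "map_inverse f q = Some p \<longleftrightarrow> f p = Some q"
proof -
  have *: "p' = p" if "f p = Some q" "f p' = Some q" for p p' q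
    using assms that by (auto simp: inj_on_def dom_def)
  have "(THE p. f p = Some q) = p" if "f p = Some q" for p
    using that * by (intro the_equality) auto
  then show ?thesis by (auto simp: map_inverse_def ran_def)
qed

lemma map_inverse_in:
  assumes "(y, f, x) \<in> bundle_bijections \<pi> X X0"
  shows "(x, map_inverse f, y) \<in> bundle_bijections \<pi> X X0"
proof -
  have i: "inj_on f (dom f)" using assms by (simp add: bundle_bijections_def)
  note iff = map_inverse_eq_Some_iff[OF i]
  have "dom (map_inverse f) = ran f" "ran (map_inverse f) = dom f"
    by (auto simp: dom_def ran_def iff)
  moreover have "inj_on (map_inverse f) (dom (map_inverse f))"
    by (rule inj_onI) (metis domD iff option.inject)
  ultimately show ?thesis using assms by (auto simp: bundle_bijections_def)
qed

lemma map_comp_in: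
  assumes "(z, g, y) \<in> bundle_bijections \<pi> X X0" "(y, f, x) \<in> bundle_bijections \<pi> X X0"
  shows "(z, g \<circ>\<^sub>m f, x) \<in> bundle_bijections \<pi> X X0"
proof -
  have ig: "inj_on g (dom g)" and i: "inj_on f (dom f)"
    using assms by (auto simp: bundle_bijections_def)
  have "inj_on (g \<circ>\<^sub>m f) (dom (g \<circ>\<^sub>m f))"
  proof (rule inj_onI)
    fix p p' assume "p \<in> dom (g \<circ>\<^sub>m f)" "p' \<in> dom (g \<circ>\<^sub>m f)" "(g \<circ>\<^sub>m f) p = (g \<circ>\<^sub>m f) p'"
    then obtain r q q' where *: "f p = Some q" "g q = Some r" "f p' = Some q'" "g q' = Some r"
      by (auto simp: map_comp_Some_iff)
    then have "q = q'" using ig by (metis domI inj_onD)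
    with * show "p = p'" using i by (metis domI inj_onD)
  qed
  moreover have "dom (g \<circ>\<^sub>m f) \<subseteq> dom f" "ran (g \<circ>\<^sub>m f) \<subseteq> ran g"
    by (auto simp: ran_def map_comp_Some_iff)
  ultimately show ?thesis using assms by (auto simp: bundle_bijections_def)
qed

lemma map_comp_assoc: "(h \<circ>\<^sub>m g) \<circ>\<^sub>m f = h \<circ>\<^sub>m (g \<circ>\<^sub>m f)"
  by (rule ext) (simp add: map_comp_def split: option.split)

lemma is_inverse_bundle_semigroupoid:
  assumes a: "(y, f, x) \<in> bundle_bijections \<pi> X X0"
  shows "is_inverse (\<I> \<pi> X X0) (y, f, x) b \<longleftrightarrow> b = (x, map_inverse f, y)"
proof
  have i: "inj_on f (dom f)" using a by (simp add: bundle_bijections_def)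
  note iff = map_inverse_eq_Some_iff[OF i]
  {
    assume b: "is_inverse (\<I> \<pi> X X0) (y, f, x) b"
    then obtain g where b_eq: "b = (x, g, y)" and g: "(x, g, y) \<in> bundle_bijections \<pi> X X0"
      and fgf: "(f \<circ>\<^sub>m g) \<circ>\<^sub>m f = f" and gfg: "(g \<circ>\<^sub>m f) \<circ>\<^sub>m g = g"
      by (cases b) (auto simp: is_inverse_def bundle_semigroupoid_def)
    have ig: "inj_on g (dom g)" using g by (simp add: bundle_bijections_def)
    have 1: "g q = Some p" if pq: "f p = Some q" for p q
    proof -
      have "((f \<circ>\<^sub>m g) \<circ>\<^sub>m f) p = Some q" using fgf pq by simp
      then obtain p' where "g q = Some p'" "f p' = Some q"
        using pq by (auto simp: map_comp_Some_iff)
      then show ?thesis using i pq by (metis domI inj_onD)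
    qed
    have 2: "f p = Some q" if pq: "g q = Some p" for p q
    proof -
      have "((g \<circ>\<^sub>m f) \<circ>\<^sub>m g) q = Some p" using gfg pq by simp
      then obtain q' where "f p = Some q'" "g q' = Some p"
        using pq by (auto simp: map_comp_Some_iff)
      then show ?thesis using ig pq by (metis domI inj_onD)
    qed
    have "g q = map_inverse f q" for q
      using 1 2 iff by (metis option.exhaust)
    then show "b = (x, map_inverse f, y)" using b_eq by auto
  }
  {
    assume b: "b = (x, map_inverse f, y)"
    have "((f \<circ>\<^sub>m map_inverse f) \<circ>\<^sub>m f) p = f p" for p
      by (cases "f p") (auto simp: map_comp_def iff[THEN iffD2])
    moreover have "((map_inverse f \<circ>\<^sub>m f) \<circ>\<^sub>m map_inverse f) q = map_inverse f q" for q
      proof (cases "map_inverse f q")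
      case (Some p)
      then have "f p = Some q" by (simp add: iff)
      with Some show ?thesis by (simp add: map_comp_def)
    qed (simp add: map_comp_def)
    ultimately show "is_inverse (\<I> \<pi> X X0) (y, f, x) b"
      using a map_inverse_in[OF a] b
      by (auto simp: is_inverse_def bundle_semigroupoid_def fun_eq_iff)
  }
qed

lemma inverse_semigroupoid_bundle_semigroupoid: "inverse_semigroupoid (\<I> \<pi> X X0)"
proof
  fix a assume "a \<in> carrier (\<I> \<pi> X X0)"
  then show "\<exists>!b. is_inverse (\<I> \<pi> X X0) a b"
    by (cases a) (auto simp: is_inverse_bundle_semigroupoid bundle_semigroupoid_def[THEN arg_cong[of _ _ carrier]])
qed (auto simp: bundle_semigroupoid_def map_comp_in map_comp_assoc)

lemma star_bundle_semigroupoid: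
  "(y, f, x) \<in> bundle_bijections \<pi> X X0 \<Longrightarrow> star (\<I> \<pi> X X0) (y, f, x) = (x, map_inverse f, y)"
  by (simp add: star_def is_inverse_bundle_semigroupoid)

end

theory Submission
  imports Defs
begin

text \<open>This is the Wagner--Preston theorem for inverse semigroupoids. As for inverse semigroups, an
  element \<open>a\<close> acts by left multiplication, as the bijection \<open>x \<mapsto> ax\<close> from \<open>{x. a\<^sup>\<star>a x = x}\<close> onto
  \<open>{y. aa\<^sup>\<star> y = y}\<close> with inverse \<open>y \<mapsto> a\<^sup>\<star>y\<close>. What the semigroupoid adds is the base of the bundle: the
  elements have to lie over vertices in such a way that \<open>ab\<close> is defined exactly when the source of
  \<open>a\<close> is the range of \<open>b\<close>, as in a category.

  The range vertex of \<open>b\<close> is taken to be the set of all \<open>c\<close> for which \<open>cb\<close> is defined, and the source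
  vertex of \<open>a\<close> to be the range vertex of \<open>a\<^sup>\<star>\<close>. If these agree then \<open>ab\<close> is defined, because \<open>aa\<^sup>\<star>\<close> is.
  The converse is the heart of the matter (\<open>composable_iff_vertex\<close>): it needs that whenever \<open>ef\<close> is
  defined for idempotents \<open>e\<close> and \<open>f\<close>, so is \<open>fe\<close>, and they are equal (\<open>idempotents_commute\<close>). A
  general semigroupoid has no such symmetry; here it comes from the uniqueness of inverses. If \<open>ab\<close>
  is defined, the symmetry gives \<open>a\<^sup>\<star>a bb\<^sup>\<star> = bb\<^sup>\<star> a\<^sup>\<star>a\<close>, and the range vertex of the two sides is
  that of \<open>a\<^sup>\<star>\<close> and that of \<open>b\<close>.

  The bundle is then the map that sends each element to its range vertex, and \<open>a\<close> is represented by
  left multiplication from the fibre over its source to the fibre over its range. Composability is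
  preserved and reflected by the choice of vertices, products by associativity and the commutation
  of idempotents (\<open>left_mult_mult\<close>), and \<open>a\<close> is recovered from its action as the image of \<open>a\<^sup>\<star>a\<close>
  (\<open>inj_on_regular_rep\<close>).\<close>

section \<open>Composability\<close>

context semigroupoid
begin

lemma composable_carrier:
  assumes "(a, b) \<in> composable \<Lambda>"
  shows "a \<in> carrier \<Lambda>" "b \<in> carrier \<Lambda>"
  using assms composable_subset by auto

lemma composable_mult_left:
  assumes "(f, g) \<in> composable \<Lambda>"
  shows "(f \<odot> g, h) \<in> composable \<Lambda> \<longleftrightarrow> (g, h) \<in> composable \<Lambda>"
  using assms composable_left_iff[of f g h] composable_carrier by blast

lemma composable_mult_right:
  assumes "(g, h) \<in> composable \<Lambda>"
  shows "(f, g \<odot> h) \<in> composable \<Lambda> \<longleftrightarrow> (f, g) \<in> composable \<Lambda>"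
  using assms composable_right_iff[of f g h] composable_carrier by blast

text \<open>As conditional rewrite rules, these equations reduce the composability of any two bracketed
  words to that of their adjacent letters, and move all brackets to the right.\<close>

lemmas composable_simps = composable_mult_left composable_mult_right assoc mult_closed

definition idempotent :: "'a \<Rightarrow> bool" where
  "idempotent e \<longleftrightarrow> (e, e) \<in> composable \<Lambda> \<and> e \<odot> e = e"

lemma idempotent_absorb:
  assumes "idempotent e" "(e, z) \<in> composable \<Lambda>"
  shows "e \<odot> (e \<odot> z) = e \<odot> z"
  using assms by (metis idempotent_def assoc)

text \<open>In the semigroupoid of arrows of a category, this set consists of the arrows that start where
  \<open>b\<close> ends, so it stands for the range object of \<open>b\<close>. The source object of \<open>a\<close> is \<open>vertex (a\<^sup>\<star>)\<close> in the
  presence of inverses.\<close>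

definition vertex :: "'a \<Rightarrow> 'a set" where
  "vertex b = {c. (c, b) \<in> composable \<Lambda>}"

lemma vertex_mult: "(a, b) \<in> composable \<Lambda> \<Longrightarrow> vertex (a \<odot> b) = vertex a"
  by (simp add: vertex_def composable_mult_right)

end

text \<open>An inverse is described by equations between defined products, all of which a homomorphism
  carries over. This spares computing the inverse partial map of a left multiplication.\<close>

lemma semigroupoid_hom_is_inverse:
  assumes "semigroupoid_hom \<Lambda> \<Gamma> \<phi>" and "is_inverse \<Lambda> a b"
    and "semigroupoid \<Lambda>"
  shows "is_inverse \<Gamma> (\<phi> a) (\<phi> b)"
proof -
  interpret semigroupoid \<Lambda> by fact
  have ab: "(a, b) \<in> composable \<Lambda>" "(b, a) \<in> composable \<Lambda>" "b \<in> carrier \<Lambda>"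
    and eqs: "(a \<odot>\<^bsub>\<Lambda>\<^esub> b) \<odot>\<^bsub>\<Lambda>\<^esub> a = a" "(b \<odot>\<^bsub>\<Lambda>\<^esub> a) \<odot>\<^bsub>\<Lambda>\<^esub> b = b"
    using assms(2) by (auto simp: is_inverse_def)
  then have "(a \<odot>\<^bsub>\<Lambda>\<^esub> b, a) \<in> composable \<Lambda>" "(b \<odot>\<^bsub>\<Lambda>\<^esub> a, b) \<in> composable \<Lambda>"
    by (simp_all add: composable_mult_left)
  with ab eqs assms(1) show ?thesis
    unfolding semigroupoid_hom_def is_inverse_def by (metis PiE)
qed

section \<open>Inverses and idempotents\<close>

context inverse_semigroupoid
begin

abbreviation inverse_element ("_\<^sup>\<star>" [1000] 999) where
  "a\<^sup>\<star> \<equiv> star S a"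

lemma is_inverse_star: "a \<in> carrier S \<Longrightarrow> is_inverse S a (a\<^sup>\<star>)"
  unfolding star_def by (rule theI') (rule ex1_inverse)

lemma star_eqI: "a \<in> carrier S \<Longrightarrow> is_inverse S a b \<Longrightarrow> a\<^sup>\<star> = b"
  using ex1_inverse is_inverse_star by blast

lemma star_facts:
  assumes "a \<in> carrier S"
  shows star_closed: "a\<^sup>\<star> \<in> carrier S"
    and composable_star: "(a, a\<^sup>\<star>) \<in> composable S" "(a\<^sup>\<star>, a) \<in> composable S"
    and mult_star_mult: "a \<odot> (a\<^sup>\<star> \<odot> a) = a" "a\<^sup>\<star> \<odot> (a \<odot> a\<^sup>\<star>) = a\<^sup>\<star>"
  using is_inverse_star[OF assms] by (auto simp: is_inverse_def assoc)

lemma star_star: "a \<in> carrier S \<Longrightarrow> (a\<^sup>\<star>)\<^sup>\<star> = a"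
  by (intro star_eqI) (auto simp: star_facts is_inverse_def assoc)

lemma idempotent_star_mult:
  assumes "a \<in> carrier S"
  shows "idempotent (a\<^sup>\<star> \<odot> a)" "idempotent (a \<odot> a\<^sup>\<star>)"
  using assms by (auto simp: idempotent_def composable_simps star_facts)

lemma star_idempotent: "idempotent e \<Longrightarrow> e\<^sup>\<star> = e"
  by (intro star_eqI) (auto simp: idempotent_def is_inverse_def dest: composable_carrier)

text \<open>Let \<open>x\<close> be the inverse of \<open>ef\<close>. Then \<open>fxe\<close> is an inverse of \<open>ef\<close> as well, so it is \<open>x\<close>; this makes
  \<open>x\<close> idempotent, hence its own inverse, so that \<open>x = ef\<close>. As it is open at this
  point whether \<open>fe\<close> is defined, every word in the calculation has \<open>x\<close> between an \<open>f\<close> and the next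
  \<open>e\<close>.\<close>

lemma idempotent_mult:
  assumes e: "idempotent e" and f: "idempotent f" and ef: "(e, f) \<in> composable S"
  shows "idempotent (e \<odot> f)"
proof -
  define x where "x = (e \<odot> f)\<^sup>\<star>"
  have c: "e \<odot> f \<in> carrier S" using ef by (rule mult_closed)
  have fx: "(f, x) \<in> composable S" and xe: "(x, e) \<in> composable S"
    using composable_star[OF c] ef by (simp_all add: x_def composable_simps)
  have efx: "e \<odot> (f \<odot> (x \<odot> (e \<odot> f))) = e \<odot> f" and xef: "x \<odot> (e \<odot> (f \<odot> x)) = x"
    using mult_star_mult[OF c] ef fx xe by (simp_all add: x_def[symmetric] composable_simps)
  have ee: "(e, e) \<in> composable S" and ff: "(f, f) \<in> composable S"
    using e f by (auto simp: idempotent_def)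
  have abs: "e \<odot> (e \<odot> z) = e \<odot> z" if "(e, z) \<in> composable S" for z
    using e that by (rule idempotent_absorb)
  have abs': "f \<odot> (f \<odot> z) = f \<odot> z" if "(f, z) \<in> composable S" for z
    using f that by (rule idempotent_absorb)
  have xef': "x \<odot> (e \<odot> (f \<odot> (x \<odot> e))) = x \<odot> e"
    using arg_cong[OF xef, of "\<lambda>t. t \<odot> e"] ef fx xe by (simp add: composable_simps)
  have "is_inverse S (e \<odot> f) (f \<odot> (x \<odot> e))"
    using ef fx xe ee ff by (simp add: is_inverse_def composable_simps abs abs' efx xef')
  then have x: "x = f \<odot> (x \<odot> e)" unfolding x_def using c by (intro star_eqI)
  have "(f \<odot> (x \<odot> e), f \<odot> (x \<odot> e)) \<in> composable S"
    using ef fx xe by (simp add: composable_simps)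
  moreover have "(f \<odot> (x \<odot> e)) \<odot> (f \<odot> (x \<odot> e)) = f \<odot> (x \<odot> e)"
    using ef fx xe by (simp add: composable_simps xef')
  ultimately have "idempotent (f \<odot> (x \<odot> e))" unfolding idempotent_def by blast
  then have "idempotent x" by (simp only: x[symmetric])
  then have "e \<odot> f = x" using star_idempotent star_star[OF c] by (simp add: x_def)
  with \<open>idempotent x\<close> show ?thesis by simp
qed

text \<open>The square of the idempotent \<open>ef\<close> is the word \<open>efef\<close>, whose middle letters can only be
  composed if \<open>fe\<close> is defined. Then \<open>fe\<close> is an inverse of \<open>ef\<close>, and so is \<open>ef\<close> itself.\<close>

lemma idempotents_commute:
  assumes e: "idempotent e" and f: "idempotent f" and ef: "(e, f) \<in> composable S"
  shows "(f, e) \<in> composable S" "e \<odot> f = f \<odot> e"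
proof -
  have i: "idempotent (e \<odot> f)" using assms by (rule idempotent_mult)
  then show fe: "(f, e) \<in> composable S"
    using ef by (simp add: idempotent_def composable_simps)
  have j: "idempotent (f \<odot> e)" using f e fe by (rule idempotent_mult)
  have ee: "(e, e) \<in> composable S" and ff: "(f, f) \<in> composable S"
    using e f by (auto simp: idempotent_def)
  have "e \<odot> (f \<odot> (e \<odot> f)) = e \<odot> f" "f \<odot> (e \<odot> (f \<odot> e)) = f \<odot> e"
    using i j ef fe by (auto simp: idempotent_def composable_simps)
  then have "is_inverse S (e \<odot> f) (f \<odot> e)"
    using ef fe ee ff
    by (simp add: is_inverse_def composable_simps idempotent_absorb[OF e] idempotent_absorb[OF f])
  then show "e \<odot> f = f \<odot> e"
    using star_eqI[OF mult_closed[OF ef]] star_idempotent[OF i] by simp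
qed

text \<open>The product \<open>ab\<close> is defined exactly when that of \<open>a\<^sup>\<star>a\<close> and \<open>bb\<^sup>\<star>\<close> is, so the symmetry for
  idempotents turns into one for arbitrary elements.\<close>

lemma
  assumes ab: "(a, b) \<in> composable S"
  shows composable_star_star: "(b\<^sup>\<star>, a\<^sup>\<star>) \<in> composable S"
    and domain_range_commute: "(a\<^sup>\<star> \<odot> a) \<odot> (b \<odot> b\<^sup>\<star>) = (b \<odot> b\<^sup>\<star>) \<odot> (a\<^sup>\<star> \<odot> a)"
proof -
  have a: "a \<in> carrier S" and b: "b \<in> carrier S" using ab by (auto dest: composable_carrier)
  note st = star_facts[OF a] star_facts[OF b]
  have ef: "(a\<^sup>\<star> \<odot> a, b \<odot> b\<^sup>\<star>) \<in> composable S" using ab st by (simp add: composable_simps)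
  note comm = idempotents_commute[OF idempotent_star_mult(1)[OF a] idempotent_star_mult(2)[OF b] ef]
  show "(b\<^sup>\<star>, a\<^sup>\<star>) \<in> composable S" using comm(1) st by (simp add: composable_simps)
  show "(a\<^sup>\<star> \<odot> a) \<odot> (b \<odot> b\<^sup>\<star>) = (b \<odot> b\<^sup>\<star>) \<odot> (a\<^sup>\<star> \<odot> a)" by (rule comm(2))
qed

text \<open>An inverse semigroupoid thus has the composability of a directed graph, with the element \<open>a\<close>
  an edge from \<open>vertex (a\<^sup>\<star>)\<close> to \<open>vertex a\<close>.\<close>

lemma composable_iff_vertex:
  assumes a: "a \<in> carrier S" and b: "b \<in> carrier S"
  shows "(a, b) \<in> composable S \<longleftrightarrow> vertex (a\<^sup>\<star>) = vertex b"
proof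
  assume "vertex (a\<^sup>\<star>) = vertex b"
  then show "(a, b) \<in> composable S"
    using composable_star(1)[OF a] by (auto simp: vertex_def)
next
  assume ab: "(a, b) \<in> composable S"
  note st = star_facts[OF a] star_facts[OF b]
  let ?e = "a\<^sup>\<star> \<odot> a" and ?f = "b \<odot> b\<^sup>\<star>"
  have ef: "(?e, ?f) \<in> composable S" using ab st by (simp add: composable_simps)
  have fe: "(?f, ?e) \<in> composable S"
    using composable_star_star[OF ab] st by (simp add: composable_simps)
  have "vertex (a\<^sup>\<star>) = vertex (?e \<odot> ?f)" using st ef by (simp add: vertex_mult)
  also have "\<dots> = vertex (?f \<odot> ?e)" by (simp only: domain_range_commute[OF ab])
  also have "\<dots> = vertex b" using st fe by (simp add: vertex_mult)
  finally show "vertex (a\<^sup>\<star>) = vertex b" .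
qed

lemma star_mult:
  assumes ab: "(a, b) \<in> composable S"
  shows "(a \<odot> b)\<^sup>\<star> = b\<^sup>\<star> \<odot> a\<^sup>\<star>"
proof (rule star_eqI)
  show "a \<odot> b \<in> carrier S" using ab by (rule mult_closed)
  have a: "a \<in> carrier S" and b: "b \<in> carrier S" using ab by (auto dest: composable_carrier)
  note st = star_facts[OF a] star_facts[OF b]
  note sw = composable_star_star[OF ab] domain_range_commute[OF ab]
  \<comment> \<open>\<open>st(1-3,6-8)\<close> leaves out the equations \<open>aa\<^sup>\<star>a = a\<close> and their like, so that both sides of a
    rebracketing step reach the same word without being shortened.\<close>
  have 1: "a \<odot> (b \<odot> (b\<^sup>\<star> \<odot> (a\<^sup>\<star> \<odot> (a \<odot> b)))) = a \<odot> b"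
  proof -
    have "a \<odot> (b \<odot> (b\<^sup>\<star> \<odot> (a\<^sup>\<star> \<odot> (a \<odot> b)))) = a \<odot> (((b \<odot> b\<^sup>\<star>) \<odot> (a\<^sup>\<star> \<odot> a)) \<odot> b)"
      using ab st sw(1) by (simp add: composable_simps)
    also have "\<dots> = a \<odot> (((a\<^sup>\<star> \<odot> a) \<odot> (b \<odot> b\<^sup>\<star>)) \<odot> b)" by (simp only: sw(2))
    also have "\<dots> = (a \<odot> (a\<^sup>\<star> \<odot> a)) \<odot> (b \<odot> (b\<^sup>\<star> \<odot> b))"
      using ab st(1-3,6-8) by (simp add: composable_simps)
    also have "\<dots> = a \<odot> b" by (simp only: st)
    finally show ?thesis .
  qed
  have 2: "b\<^sup>\<star> \<odot> (a\<^sup>\<star> \<odot> (a \<odot> (b \<odot> (b\<^sup>\<star> \<odot> a\<^sup>\<star>)))) = b\<^sup>\<star> \<odot> a\<^sup>\<star>"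
  proof -
    have "b\<^sup>\<star> \<odot> (a\<^sup>\<star> \<odot> (a \<odot> (b \<odot> (b\<^sup>\<star> \<odot> a\<^sup>\<star>)))) = b\<^sup>\<star> \<odot> (((a\<^sup>\<star> \<odot> a) \<odot> (b \<odot> b\<^sup>\<star>)) \<odot> a\<^sup>\<star>)"
      using ab st sw(1) by (simp add: composable_simps)
    also have "\<dots> = b\<^sup>\<star> \<odot> (((b \<odot> b\<^sup>\<star>) \<odot> (a\<^sup>\<star> \<odot> a)) \<odot> a\<^sup>\<star>)" by (simp only: sw(2))
    also have "\<dots> = (b\<^sup>\<star> \<odot> (b \<odot> b\<^sup>\<star>)) \<odot> (a\<^sup>\<star> \<odot> (a \<odot> a\<^sup>\<star>))"
      using ab st(1-3,6-8) sw(1) by (simp add: composable_simps)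
    also have "\<dots> = b\<^sup>\<star> \<odot> a\<^sup>\<star>" by (simp only: st)
    finally show ?thesis .
  qed
  show "is_inverse S (a \<odot> b) (b\<^sup>\<star> \<odot> a\<^sup>\<star>)"
    using ab st sw(1) by (simp add: is_inverse_def composable_simps 1 2)
qed

section \<open>The left regular representation\<close>

text \<open>Left multiplication by \<open>a\<close> need not be injective where it is defined; it is on the image of
  \<open>a\<^sup>\<star>a\<close>, where multiplication by \<open>a\<^sup>\<star>\<close> undoes it.\<close>

definition left_mult :: "'a \<Rightarrow> 'a \<rightharpoonup> 'a" where
  "left_mult a x = (if (a, x) \<in> composable S \<and> (a\<^sup>\<star> \<odot> a) \<odot> x = x then Some (a \<odot> x) else None)"

lemma left_mult_eq_Some_iff:
  "left_mult a x = Some y \<longleftrightarrow> (a, x) \<in> composable S \<and> (a\<^sup>\<star> \<odot> a) \<odot> x = x \<and> y = a \<odot> x"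
  by (auto simp: left_mult_def)

definition regular_rep :: "'a \<Rightarrow> 'a set \<times> ('a \<rightharpoonup> 'a) \<times> 'a set" where
  "regular_rep a = (vertex a, left_mult a, vertex (a\<^sup>\<star>))"

abbreviation vertices :: "'a set set" where
  "vertices \<equiv> vertex ` carrier S"

abbreviation regular_bundle :: "('a set \<times> ('a \<rightharpoonup> 'a) \<times> 'a set) partial_magma" where
  "regular_bundle \<equiv> \<I> vertex (carrier S) vertices"

lemma regular_rep_in_bundle_bijections:
  assumes a: "a \<in> carrier S"
  shows "regular_rep a \<in> bundle_bijections vertex (carrier S) vertices"
proof -
  have "inj_on (left_mult a) (dom (left_mult a))"
  proof (rule inj_onI)
    fix x y assume "x \<in> dom (left_mult a)" "y \<in> dom (left_mult a)" "left_mult a x = left_mult a y"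
    then have "(a, x) \<in> composable S" "(a, y) \<in> composable S" "a \<odot> x = a \<odot> y"
      "x = (a\<^sup>\<star> \<odot> a) \<odot> x" "y = (a\<^sup>\<star> \<odot> a) \<odot> y"
      by (auto simp: dom_def left_mult_def split: if_splits)
    then show "x = y" using star_facts[OF a] by (metis assoc)
  qed
  moreover have "x \<in> carrier S" "vertex x = vertex (a\<^sup>\<star>)" if "x \<in> dom (left_mult a)" for x
    using that a composable_iff_vertex[OF a]
    by (auto simp: dom_def left_mult_eq_Some_iff dest: composable_carrier)
  moreover have "y \<in> carrier S" "vertex y = vertex a" if "y \<in> ran (left_mult a)" for y
    using that by (auto simp: ran_def left_mult_eq_Some_iff vertex_mult mult_closed)
  ultimately show ?thesis
    using a star_closed[OF a] by (auto simp: bundle_bijections_def regular_rep_def)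
qed

text \<open>The values agree by associativity; what has to be shown is that the domains do. A point of the
  domain of \<open>ab\<close> has the form \<open>x = b\<^sup>\<star>z\<close> with \<open>z = a\<^sup>\<star>a bx\<close>. The form \<open>b\<^sup>\<star>z\<close> makes \<open>b\<^sup>\<star>b\<close> fix \<open>x\<close>, and
  commuting \<open>bb\<^sup>\<star>\<close> past \<open>a\<^sup>\<star>a\<close> gives \<open>bx = bb\<^sup>\<star> a\<^sup>\<star>a bx = a\<^sup>\<star>a bx\<close>, so that \<open>bx\<close> is in the domain of
  \<open>a\<close>.\<close>

lemma left_mult_mult:
  assumes ab: "(a, b) \<in> composable S"
  shows "left_mult (a \<odot> b) = left_mult a \<circ>\<^sub>m left_mult b"
proof
  fix x
  have a: "a \<in> carrier S" and b: "b \<in> carrier S" using ab by (auto dest: composable_carrier)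
  note st = star_facts[OF a] star_facts[OF b]
  note sw = composable_star_star[OF ab] domain_range_commute[OF ab]
  have dom: "((a \<odot> b)\<^sup>\<star> \<odot> (a \<odot> b)) \<odot> x = x \<longleftrightarrow>
      (b\<^sup>\<star> \<odot> b) \<odot> x = x \<and> (a\<^sup>\<star> \<odot> a) \<odot> (b \<odot> x) = b \<odot> x" (is "?l \<longleftrightarrow> ?r1 \<and> ?r2")
    if bx: "(b, x) \<in> composable S"
  proof -
    have l: "((a \<odot> b)\<^sup>\<star> \<odot> (a \<odot> b)) \<odot> x = b\<^sup>\<star> \<odot> ((a\<^sup>\<star> \<odot> a) \<odot> (b \<odot> x))"
      using ab bx st(1-3,6-8) sw(1) by (simp add: star_mult composable_simps)
    show ?thesis
    proof
      assume "?r1 \<and> ?r2"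
      then show ?l using l bx st by (simp add: assoc)
    next
      assume ?l
      with l have x: "b\<^sup>\<star> \<odot> ((a\<^sup>\<star> \<odot> a) \<odot> (b \<odot> x)) = x" by simp
      let ?z = "(a\<^sup>\<star> \<odot> a) \<odot> (b \<odot> x)"
      have bz: "(b\<^sup>\<star>, ?z) \<in> composable S" using ab bx st sw(1) by (simp add: composable_simps)
      have "(b\<^sup>\<star> \<odot> b) \<odot> (b\<^sup>\<star> \<odot> ?z) = (b\<^sup>\<star> \<odot> (b \<odot> b\<^sup>\<star>)) \<odot> ?z"
        using bz st(1-3,6-8) by (simp add: assoc composable_mult_left composable_mult_right)
      then have r1: ?r1 using x st by simp
      have "b \<odot> x = (b \<odot> b\<^sup>\<star>) \<odot> ?z" using x bz st by (simp add: assoc)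
      also have "\<dots> = ((b \<odot> b\<^sup>\<star>) \<odot> (a\<^sup>\<star> \<odot> a)) \<odot> (b \<odot> x)"
        using ab bx st(1-3,6-8) sw(1) by (simp add: composable_simps)
      also have "\<dots> = ((a\<^sup>\<star> \<odot> a) \<odot> (b \<odot> b\<^sup>\<star>)) \<odot> (b \<odot> x)" by (simp only: sw(2))
      also have "\<dots> = (a\<^sup>\<star> \<odot> a) \<odot> ((b \<odot> (b\<^sup>\<star> \<odot> b)) \<odot> x)"
        using ab bx st(1-3,6-8) by (simp add: composable_simps)
      also have "\<dots> = (a\<^sup>\<star> \<odot> a) \<odot> (b \<odot> x)" using st by simp
      finally show "?r1 \<and> ?r2" using r1 by simp
    qed
  qed
  have "left_mult (a \<odot> b) x = Some y \<longleftrightarrow> (left_mult a \<circ>\<^sub>m left_mult b) x = Some y" for y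
    using ab dom by (auto simp: map_comp_Some_iff left_mult_eq_Some_iff composable_simps)
  then show "left_mult (a \<odot> b) x = (left_mult a \<circ>\<^sub>m left_mult b) x"
    by (metis option.exhaust)
qed

lemma composable_regular_rep_iff:
  assumes "a \<in> carrier S" "b \<in> carrier S"
  shows "(regular_rep a, regular_rep b) \<in> composable regular_bundle \<longleftrightarrow> (a, b) \<in> composable S"
  using assms regular_rep_in_bundle_bijections[of a] regular_rep_in_bundle_bijections[of b]
  by (auto simp: regular_rep_def bundle_semigroupoid_def composable_iff_vertex)

lemma regular_rep_mult:
  assumes ab: "(a, b) \<in> composable S"
  shows "regular_rep (a \<odot> b) = regular_rep a \<odot>\<^bsub>regular_bundle\<^esub> regular_rep b"
  using ab composable_star_star[OF ab]
  by (simp add: regular_rep_def bundle_semigroupoid_def left_mult_mult vertex_mult star_mult)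

lemma regular_rep_hom: "semigroupoid_hom S regular_bundle regular_rep"
  unfolding semigroupoid_hom_def
proof (intro conjI allI impI)
  show "regular_rep \<in> carrier S \<rightarrow> carrier regular_bundle"
    using regular_rep_in_bundle_bijections by (simp add: bundle_semigroupoid_def)
qed (simp_all add: composable_carrier composable_regular_rep_iff regular_rep_mult)

lemma star_regular_rep:
  assumes a: "a \<in> carrier S"
  shows "star regular_bundle (regular_rep a) = regular_rep (a\<^sup>\<star>)"
proof -
  interpret R: inverse_semigroupoid regular_bundle
    by (rule inverse_semigroupoid_bundle_semigroupoid)
  show ?thesis
  proof (rule R.star_eqI)
    show "regular_rep a \<in> carrier regular_bundle"
      using regular_rep_hom a by (auto simp: semigroupoid_hom_def)
    show "is_inverse regular_bundle (regular_rep a) (regular_rep (a\<^sup>\<star>))"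
      using regular_rep_hom is_inverse_star[OF a] semigroupoid_axioms
      by (rule semigroupoid_hom_is_inverse)
  qed
qed

lemma left_mult_domain_idempotent:
  assumes "a \<in> carrier S"
  shows "left_mult a (a\<^sup>\<star> \<odot> a) = Some a"
  using star_facts[OF assms] idempotent_star_mult(1)[OF assms]
  by (simp add: left_mult_eq_Some_iff composable_simps idempotent_def)

text \<open>If \<open>a\<close> and \<open>b\<close> act alike, then \<open>a\<^sup>\<star>a\<close> is in the domain of both actions, and so is \<open>b\<^sup>\<star>b\<close>. Each of
  these idempotents is therefore fixed by the other; as they commute they are equal, and the common
  action sends them to both \<open>a\<close> and \<open>b\<close>.\<close>

lemma inj_on_regular_rep: "inj_on regular_rep (carrier S)"
proof (rule inj_onI)
  fix a b assume a: "a \<in> carrier S" and b: "b \<in> carrier S" and "regular_rep a = regular_rep b"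
  then have eq: "left_mult a = left_mult b" by (simp add: regular_rep_def)
  let ?e = "a\<^sup>\<star> \<odot> a" and ?f = "b\<^sup>\<star> \<odot> b"
  have "left_mult b ?e = Some a" "left_mult a ?f = Some b"
    using left_mult_domain_idempotent[OF a] left_mult_domain_idempotent[OF b] eq by simp_all
  then have be: "(b, ?e) \<in> composable S" "?f \<odot> ?e = ?e" "a = b \<odot> ?e" and "?e \<odot> ?f = ?f"
    by (auto simp: left_mult_eq_Some_iff)
  moreover have "?f \<odot> ?e = ?e \<odot> ?f"
  proof (rule idempotents_commute(2))
    show "(?f, ?e) \<in> composable S" using be(1) star_facts[OF b] by (simp add: composable_mult_left)
  qed (use a b idempotent_star_mult in auto)
  ultimately have "?e = ?f" by simp
  then show "a = b" using be(3) mult_star_mult(1)[OF b] by simp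
qed

lemma sub_inverse_semigroupoid_range_regular_rep:
  "sub_inverse_semigroupoid regular_bundle (regular_rep ` carrier S)"
proof -
  interpret R: inverse_semigroupoid regular_bundle
    by (rule inverse_semigroupoid_bundle_semigroupoid)
  show ?thesis
  proof
    show "regular_rep ` carrier S \<subseteq> carrier regular_bundle"
      using regular_rep_hom by (auto simp: semigroupoid_hom_def)
  next
    fix u v assume "u \<in> regular_rep ` carrier S" "v \<in> regular_rep ` carrier S"
      and uv: "(u, v) \<in> composable regular_bundle"
    then obtain a b where ab: "a \<in> carrier S" "b \<in> carrier S" "u = regular_rep a" "v = regular_rep b"
      by auto
    then have "(a, b) \<in> composable S" using uv by (simp add: composable_regular_rep_iff)
    then show "u \<odot>\<^bsub>regular_bundle\<^esub> v \<in> regular_rep ` carrier S"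
      using ab regular_rep_mult mult_closed by (metis imageI)
  next
    fix u assume "u \<in> regular_rep ` carrier S"
    then show "star regular_bundle u \<in> regular_rep ` carrier S"
      using star_regular_rep star_closed by auto
  qed
qed

lemma regular_rep_iso:
  "semigroupoid_iso S (restrict_magma regular_bundle (regular_rep ` carrier S)) regular_rep"
  (is "semigroupoid_iso S ?R regular_rep")
  unfolding semigroupoid_iso_def
proof (intro conjI)
  let ?inv = "inv_into (carrier S) regular_rep"
  have inv: "?inv (regular_rep a) = a" if "a \<in> carrier S" for a
    using inj_on_regular_rep that by (rule inv_into_f_f)
  show "semigroupoid_hom S ?R regular_rep"
    using regular_rep_hom by (auto simp: semigroupoid_hom_def restrict_magma_def dest: composable_carrier)
  show "bij_betw regular_rep (carrier S) (carrier ?R)"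
    using inj_on_regular_rep by (simp add: bij_betw_def restrict_magma_def)
  show "semigroupoid_hom ?R S ?inv"
    unfolding semigroupoid_hom_def
  proof (intro conjI allI impI)
    show "?inv \<in> carrier ?R \<rightarrow> carrier S" by (auto simp: restrict_magma_def inv)
  next
    fix u v assume uv: "(u, v) \<in> composable ?R"
    then obtain a b where ab: "a \<in> carrier S" "b \<in> carrier S" "u = regular_rep a" "v = regular_rep b"
      by (auto simp: restrict_magma_def)
    with uv have c: "(a, b) \<in> composable S"
      by (simp add: restrict_magma_def composable_regular_rep_iff)
    then show "(?inv u, ?inv v) \<in> composable S" using ab by (simp add: inv)
    show "?inv (u \<odot>\<^bsub>?R\<^esub> v) = ?inv u \<odot> ?inv v"
      using ab c inv[OF mult_closed[OF c]]
      by (simp add: restrict_magma_def inv flip: regular_rep_mult)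
  qed
qed

end

theorem theorem2p32:
  fixes S :: "'a partial_magma"
  assumes "inverse_semigroupoid S"
  shows "\<exists>(X :: 'a set) (X0 :: 'a set set) (\<pi> :: 'a \<Rightarrow> 'a set) B.
           is_bundle \<pi> X X0 \<and>
           sub_inverse_semigroupoid (\<I> \<pi> X X0) B \<and>
           isomorphic S (restrict_magma (\<I> \<pi> X X0) B)"
proof -
  interpret inverse_semigroupoid S by fact
  have "is_bundle vertex (carrier S) vertices" by (simp add: is_bundle_def)
  then show ?thesis
    using sub_inverse_semigroupoid_range_regular_rep regular_rep_iso
    unfolding isomorphic_def by blast
qed

end
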